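(* For every $\epsilon>0$, the set of limit points of $\mathcal{Z}$ that lie in the interval $(\tfrac13-\epsilon,\tfrac13)$ is uncountable.
   Context: For a rational number $a/b$ in lowest terms with $b\ge 2$, set $\mathcal{Z}(a/b)=\min_{q\in\mathbb{N},\,0<q<b} q\,\|qa/b\|$, where $\|x\|$ denotes the distance from $x$ to the nearest integer. The $\mathcal{Z}$-spectrum is the set $\mathcal{Z}=\{\mathcal{Z}(a/b): a/b\in\mathbb{Q}\}$. *)

theory Defs
  imports "HOL-Analysis.Analysis"
begin

definition dist_int :: "real \<Rightarrow> real" where
  "dist_int x = min (frac x) (1 - frac x)"

definition Zval :: "int \<Rightarrow> int \<Rightarrow> real" where
  "Zval a b = Min ((\<lambda>q. real_of_int q * dist_int (real_of_int q * real_of_int a / real_of_int b)) ` {q. 0 < q \<and> q < b})"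

definition Zspec :: "real set" where
  "Zspec = {Zval a b | a b. b \<ge> 2 \<and> coprime a b}"

end

theory Submission
  imports Defs
begin

text \<open>
  For a finite word w of positive integers with value a/b = [0; w], best approximation gives
  1/Z(a/b) = max (c + [0; rev l] + [0; r]), the maximum running over all splittings w = l c r.
  Since [2; 1, 1, x] + [0; 2, x] = 3, words in which the pairs 22 are separated by long even runs
  of ones have all these sums close to 3 or below. In the word
  1^(2N) 22 1^(2L_1) 22 1^(2L_2) 22 ... with each L_i equal to N+2 or N+3, the maximum sits at the
  first pair 22: it exceeds 3, tends to 3 as N grows, and is an injective function of the value s
  of the tail that starts with 1^(2L_1). The tail values are the orbit of a point under two
  injective maps with disjoint images, so their closure is uncountable; as Z is countable, all but
  countably many of the resulting points in the closure of Z are limit points.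
\<close>

section \<open>Continuants\<close>

text \<open>The product of the matrices with rows (a, 1), (1, 0), a ranging over the word, applied to a
  vector; its columns are (den, num) and (den', num').\<close>

fun act :: "int list \<Rightarrow> int \<times> int \<Rightarrow> int \<times> int" where
  "act [] v = v"
| "act (a # l) v = (a * fst (act l v) + snd (act l v), fst (act l v))"

definition den :: "int list \<Rightarrow> int" where "den l = fst (act l (1, 0))"
definition num :: "int list \<Rightarrow> int" where "num l = snd (act l (1, 0))"
definition den' :: "int list \<Rightarrow> int" where "den' l = fst (act l (0, 1))"
definition num' :: "int list \<Rightarrow> int" where "num' l = snd (act l (0, 1))"

lemma act_append: "act (l @ r) v = act l (act r v)"
  by (induction l) auto

lemma act_linear: "act l (x, y) = (x * den l + y * den' l, x * num l + y * num' l)"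
  by (induction l) (auto simp: den_def num_def den'_def num'_def algebra_simps)

lemma den_num_simps [simp]:
  "den [] = 1" "num [] = 0" "den' [] = 0" "num' [] = 1"
  "den (a # l) = a * den l + num l" "num (a # l) = den l"
  "den' (a # l) = a * den' l + num' l" "num' (a # l) = den' l"
  by (auto simp: den_def num_def den'_def num'_def)

lemma act_1_0: "act l (1, 0) = (den l, num l)"
  by (simp add: den_def num_def)

lemma den_append: "den (l @ r) = den r * den l + num r * den' l"
  and num_append: "num (l @ r) = den r * num l + num r * num' l"
  using act_append[of l r "(1, 0)"] by (auto simp: act_1_0 act_linear)

lemma den'_append: "den' (l @ r) = den' r * den l + num' r * den' l"
  and num'_append: "num' (l @ r) = den' r * num l + num' r * num' l"
proof -
  have "act (l @ r) (0, 1) = (den' (l @ r), num' (l @ r))"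
    "act r (0, 1) = (den' r, num' r)"
    by (simp_all add: den'_def num'_def)
  then show "den' (l @ r) = den' r * den l + num' r * den' l"
    "num' (l @ r) = den' r * num l + num' r * num' l"
    using act_append[of l r "(0, 1)"] by (auto simp: act_linear)
qed

text \<open>Each factor matrix has determinant -1.\<close>

lemma continuant_det: "den l * num' l - num l * den' l = (-1) ^ length l"
  by (induction l) (auto simp: algebra_simps)

text \<open>The factor matrices are symmetric, so reversing the word transposes their
  product.\<close>

lemma continuant_rev:
  "den (rev l) = den l \<and> num (rev l) = den' l \<and> den' (rev l) = num l \<and> num' (rev l) = num' l"
  by (induction l) (auto simp: den_append num_append den'_append num'_append algebra_simps)

lemma continuant_pos:
  assumes "\<forall>a\<in>set l. 1 \<le> a"
  shows "1 \<le> den l \<and> 0 \<le> num l \<and> 0 \<le> den' l \<and> 0 \<le> num' l"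
  using assms
proof (induction l)
  case (Cons a l)
  then have IH: "1 \<le> den l" "0 \<le> num l" "0 \<le> den' l" "0 \<le> num' l" and a: "1 \<le> a" by auto
  have "1 * 1 \<le> a * den l" using IH a by (intro mult_mono) auto
  moreover have "0 \<le> a * den' l" using IH a by simp
  ultimately show ?case using IH by simp
qed simp

lemma coprime_num_den: "coprime (num l) (den l)"
proof (rule coprimeI)
  fix d assume "d dvd num l" "d dvd den l"
  then have "d dvd den l * num' l - num l * den' l" by simp
  then have "d dvd (-1) ^ length l" by (simp add: continuant_det)
  moreover have "is_unit ((-1 :: int) ^ length l)" by (cases "even (length l)") auto
  ultimately show "is_unit d" by (rule dvd_trans)
qed

section \<open>Best approximations\<close>

text \<open>By unimodularity (q, p) is an integer combination of (q0, p0) and (q1, p1). The range of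
  q forces m to be nonzero and m, n not to share a sign; as the two errors do not share a sign
  either, their contributions add up without cancellation.\<close>

lemma best_approximation:
  fixes a b p q p0 q0 p1 q1 :: int
  assumes det: "\<bar>q0 * p1 - p0 * q1\<bar> = 1"
    and opp: "(q0 * a - p0 * b) * (q1 * a - p1 * b) \<le> 0"
    and q: "0 < q0" "0 < q" "q < q1"
  shows "\<bar>q0 * a - p0 * b\<bar> \<le> \<bar>q * a - p * b\<bar>"
proof -
  define e where "e = q0 * p1 - p0 * q1"
  have ee: "e * e = 1" using det unfolding e_def[symmetric] by (auto simp: abs_if split: if_splits)
  \<comment> \<open>Cramer's rule: multiplying by the determinant \<open>e\<close> replaces dividing
    by it, since e = 1 or e = -1.\<close>
  define m where "m = e * (q * p1 - p * q1)"
  define n where "n = e * (q0 * p - p0 * q)"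
  have "m * q0 + n * q1 = e * e * q" unfolding m_def n_def e_def by (simp add: algebra_simps)
  then have mq: "q = m * q0 + n * q1" using ee by simp
  have "m * p0 + n * p1 = e * e * p" unfolding m_def n_def e_def by (simp add: algebra_simps)
  then have mp: "p = m * p0 + n * p1" using ee by simp
  define d0 where "d0 = q0 * a - p0 * b"
  define d1 where "d1 = q1 * a - p1 * b"
  have d: "q * a - p * b = m * d0 + n * d1"
    unfolding mq mp d0_def d1_def by (simp add: algebra_simps)
  have opp': "d0 * d1 \<le> 0" using opp by (simp add: d0_def d1_def)
  have q1: "0 < q1" using q by simp
  have "m \<noteq> 0 \<and> m * n \<le> 0"
  proof (cases "n = 0")
    case True
    then show ?thesis using mq q by auto
  next
    case False
    show ?thesis
    proof (cases "n > 0")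
      case True
      then have "1 * q1 \<le> n * q1" using q1 by (intro mult_right_mono) auto
      then have "m * q0 < 0" using mq q by linarith
      then have "m < 0" using q by (simp add: mult_less_0_iff)
      then show ?thesis using True by (simp add: mult_le_0_iff)
    next
      case f: False
      then have "n * q1 < 0" using False q1 by (simp add: mult_less_0_iff)
      then have "0 < m * q0" using mq q by linarith
      then have "0 < m" using q by (simp add: zero_less_mult_iff)
      then show ?thesis using f by (simp add: mult_le_0_iff)
    qed
  qed
  then have m: "m \<noteq> 0" and mn: "m * n \<le> 0" by auto
  have "0 \<le> (m * n) * (d0 * d1)" using mn opp' by (simp add: mult_nonpos_nonpos)
  then have "0 \<le> (m * d0) * (n * d1)" by (simp add: algebra_simps)
  then have "\<bar>m * d0 + n * d1\<bar> = \<bar>m * d0\<bar> + \<bar>n * d1\<bar>"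
    by (auto simp: zero_le_mult_iff)
  moreover have "1 * \<bar>d0\<bar> \<le> \<bar>m\<bar> * \<bar>d0\<bar>" using m by (intro mult_right_mono) auto
  ultimately show ?thesis unfolding d d0_def[symmetric] abs_mult
    using mult_nonneg_nonneg[OF abs_ge_zero[of n] abs_ge_zero[of d1]] by linarith
qed

lemma convergent_bracket:
  assumes "1 \<le> q" "q < den w"
  shows "\<exists>l c r. w = l @ c # r \<and> den l \<le> q \<and> q < den (l @ [c])"
  using assms
proof (induction w rule: rev_induct)
  case (snoc c u)
  show ?case
  proof (cases "q < den u")
    case True
    then obtain l d r where "u = l @ d # r" "den l \<le> q" "q < den (l @ [d])"
      using snoc by blast
    then show ?thesis by (intro exI[of _ l] exI[of _ d] exI[of _ "r @ [c]"]) auto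
  next
    case False
    then show ?thesis using snoc.prems by (intro exI[of _ u] exI[of _ c] exI[of _ "[]"]) auto
  qed
qed simp

text \<open>Expanding \<open>l @ r\<close> over the columns of \<open>l\<close>, the
  \<open>den r\<close> terms cancel and the determinant times \<open>num r\<close> remains.\<close>

lemma convergent_error:
  "den l * num (l @ r) - num l * den (l @ r) = (-1) ^ length l * num r"
  unfolding continuant_det[symmetric] den_append num_append by (simp add: algebra_simps)

text \<open>Consecutive convergents \<open>l\<close> and \<open>l @ [c]\<close> have errors that
  alternate in sign, so \<open>best_approximation\<close> applies between their
  denominators.\<close>

lemma convergent_lower_bound:
  assumes pos: "\<forall>a\<in>set w. 1 \<le> a" and q: "1 \<le> q" "q < den w"
  shows "\<exists>l c r. w = l @ c # r \<and> den l \<le> q \<and> den r \<le> \<bar>q * num w - p * den w\<bar>"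
proof -
  obtain l c r where w: "w = l @ c # r" and l: "den l \<le> q" "q < den (l @ [c])"
    using convergent_bracket[OF q] by blast
  have pr: "1 \<le> den r" "0 \<le> num r" and pl: "1 \<le> den l"
    using pos w continuant_pos[of r] continuant_pos[of l] by auto
  have e0: "den l * num w - num l * den w = (-1) ^ length l * den r"
    using convergent_error[of l "c # r"] by (simp add: w)
  have e1: "den (l @ [c]) * num w - num (l @ [c]) * den w = (-1) ^ Suc (length l) * num r"
    using convergent_error[of "l @ [c]" r] by (simp add: w)
  have "\<bar>den l * num w - num l * den w\<bar> \<le> \<bar>q * num w - p * den w\<bar>"
  proof (rule best_approximation[of "den l" "num (l @ [c])" "num l" "den (l @ [c])"])
    show "\<bar>den l * num (l @ [c]) - num l * den (l @ [c])\<bar> = 1"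
      by (simp add: convergent_error power_abs)
    have "((-1) ^ length l * den r) * ((-1) ^ Suc (length l) * num r) = - (den r * num r)"
      by (cases "even (length l)") auto
    then show "(den l * num w - num l * den w) *
        (den (l @ [c]) * num w - num (l @ [c]) * den w) \<le> 0"
      unfolding e0 e1 using mult_nonneg_nonneg[of "den r" "num r"] pr by linarith
  qed (use l pl q in auto)
  then show ?thesis using w l pr unfolding e0 by (auto simp: abs_mult power_abs)
qed

section \<open>Reading the spectrum off continued fractions\<close>

text \<open>The continued fraction [0; l], with integer part 0.\<close>

fun cf :: "int list \<Rightarrow> real" where
  "cf [] = 0"
| "cf (a # l) = 1 / (real_of_int a + cf l)"

lemma cf_eq_num_den:
  assumes "\<forall>a\<in>set l. 1 \<le> a"
  shows "cf l = real_of_int (num l) / real_of_int (den l)"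
  using assms
proof (induction l)
  case (Cons a l)
  then have d: "0 < real_of_int (den l)" using continuant_pos[of l] by auto
  have "real_of_int (num (a # l)) / real_of_int (den (a # l))
      = 1 / ((real_of_int a * real_of_int (den l) + real_of_int (num l)) / real_of_int (den l))"
    by simp
  also have "\<dots> = 1 / (real_of_int a + cf l)"
    using Cons d by (simp add: add_divide_distrib)
  finally show ?case by simp
qed simp

lemma cf_bounds:
  assumes "\<forall>a\<in>set l. 1 \<le> a"
  shows "0 \<le> cf l \<and> cf l \<le> 1"
  using assms by (induction l) auto

text \<open>The left side is q |q a/b - p| at the convergent given by \<open>l\<close>. Expand the
  denominator of the whole word and divide by \<open>den l\<close> times \<open>den r\<close>; by
  transposition \<open>cf (rev l)\<close> is \<open>den' l / den l\<close>.\<close>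

lemma convergent_value:
  assumes pos: "\<forall>a\<in>set (l @ c # r). 1 \<le> a"
  shows "real_of_int (den l) * real_of_int (den r) / real_of_int (den (l @ c # r))
    = 1 / (real_of_int c + cf (rev l) + cf r)"
proof -
  have p: "1 \<le> den r" "1 \<le> den l" using pos continuant_pos[of r] continuant_pos[of l] by auto
  have "cf (rev l) = real_of_int (den' l) / real_of_int (den l)"
    "cf r = real_of_int (num r) / real_of_int (den r)"
    using pos continuant_rev[of l] by (simp_all add: cf_eq_num_den)
  moreover have "real_of_int (den (l @ c # r)) = real_of_int (den l) * real_of_int (den r) *
      (real_of_int c + real_of_int (den' l) / real_of_int (den l) + real_of_int (num r) / real_of_int (den r))"
    using p by (simp add: den_append field_simps)
  ultimately show ?thesis using p by simp
qed

section \<open>Distance to the nearest integer, and evaluation of Z\<close>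

lemma dist_int_le: "dist_int x \<le> \<bar>x - of_int p\<bar>"
proof (cases "p \<le> \<lfloor>x\<rfloor>")
  case True
  then have "real_of_int p \<le> of_int \<lfloor>x\<rfloor>" by simp
  then show ?thesis unfolding dist_int_def frac_def by linarith
next
  case False
  then have "real_of_int p \<ge> of_int \<lfloor>x\<rfloor> + 1" by linarith
  then show ?thesis unfolding dist_int_def frac_def by linarith
qed

lemma dist_int_attained: "\<exists>p. dist_int x = \<bar>x - of_int p\<bar>"
proof (cases "frac x \<le> 1 - frac x")
  case True
  then have "dist_int x = \<bar>x - of_int \<lfloor>x\<rfloor>\<bar>" unfolding dist_int_def frac_def by linarith
  then show ?thesis by blast
next
  case False
  then have "dist_int x = \<bar>x - of_int (\<lfloor>x\<rfloor> + 1)\<bar>" unfolding dist_int_def frac_def by simp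
  then show ?thesis by blast
qed

text \<open>The convergent at \<open>l0\<close> gives the upper bound; every other q is compared
  with the convergent whose denominator lies just below it.\<close>

lemma Zval_continued_fraction:
  assumes pos: "\<forall>a\<in>set w. 1 \<le> a" and w: "w = l0 @ c0 # r0" and c0: "2 \<le> c0"
    and lam: "lam = real_of_int c0 + cf (rev l0) + cf r0"
    and max: "\<And>l c r. w = l @ c # r \<Longrightarrow> real_of_int c + cf (rev l) + cf r \<le> lam"
  shows "2 \<le> den w" "Zval (num w) (den w) = 1 / lam"
proof -
  let ?f = "\<lambda>q. real_of_int q * dist_int (real_of_int q * real_of_int (num w) / real_of_int (den w))"
  have p: "1 \<le> den r0" "1 \<le> den l0" "0 \<le> num r0" "0 \<le> den' l0"
    using pos w continuant_pos[of r0] continuant_pos[of l0] by auto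
  \<comment> \<open>A centre of at least 2 makes \<open>den w\<close> at least twice
    \<open>den l0\<close>, so \<open>den l0\<close> is an admissible q.\<close>
  have "2 * 1 \<le> c0 * den r0" using p c0 by (intro mult_mono) auto
  then have "2 * den l0 \<le> (c0 * den r0 + num r0) * den l0" using p by (intro mult_right_mono) auto
  moreover have "0 \<le> den r0 * den' l0" using p by simp
  ultimately have b: "2 * den l0 \<le> den w" unfolding w den_append den_num_simps by linarith
  then show b2: "2 \<le> den w" using p by linarith
  have scale: "\<bar>real_of_int q * real_of_int (num w) / real_of_int (den w) - real_of_int p'\<bar>
      = real_of_int \<bar>q * num w - p' * den w\<bar> / real_of_int (den w)" for q p'
    using b2 by (simp add: field_simps abs_divide)
  have fin: "finite {q::int. 0 < q \<and> q < den w}"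
    by (rule finite_subset[of _ "{0..den w}"]) auto
  have mem: "den l0 \<in> {q. 0 < q \<and> q < den w}" using b p by auto
  have "\<bar>den l0 * num w - num l0 * den w\<bar> = den r0"
    using convergent_error[of l0 "c0 # r0"] p by (simp add: w abs_mult power_abs)
  then have "dist_int (real_of_int (den l0) * real_of_int (num w) / real_of_int (den w))
      \<le> real_of_int (den r0) / real_of_int (den w)"
    using dist_int_le[of "real_of_int (den l0) * real_of_int (num w) / real_of_int (den w)" "num l0"]
    unfolding scale by simp
  then have "?f (den l0) \<le> real_of_int (den l0) * (real_of_int (den r0) / real_of_int (den w))"
    using p by (intro mult_left_mono) auto
  also have "\<dots> = 1 / lam"
    using convergent_value[of l0 c0 r0] pos by (simp add: w lam)
  finally have upper: "?f (den l0) \<le> 1 / lam" .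
  have lower: "1 / lam \<le> ?f q" if q: "q \<in> {q. 0 < q \<and> q < den w}" for q
  proof -
    obtain p' where p': "dist_int (real_of_int q * real_of_int (num w) / real_of_int (den w))
        = \<bar>real_of_int q * real_of_int (num w) / real_of_int (den w) - real_of_int p'\<bar>"
      using dist_int_attained by blast
    obtain l c r where s: "w = l @ c # r" "den l \<le> q" "den r \<le> \<bar>q * num w - p' * den w\<bar>"
      using convergent_lower_bound[OF pos, of q p'] q by auto
    have pp: "1 \<le> den r" "1 \<le> den l" and c: "1 \<le> c"
      using pos s(1) continuant_pos[of r] continuant_pos[of l] by auto
    have "0 \<le> cf (rev l)" "0 \<le> cf r" using pos s(1) cf_bounds[of "rev l"] cf_bounds[of r] by auto
    then have "0 < real_of_int c + cf (rev l) + cf r" using c by simp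
    then have "1 / lam \<le> 1 / (real_of_int c + cf (rev l) + cf r)"
      using max[OF s(1)] by (intro divide_left_mono) (auto intro!: mult_pos_pos)
    also have "\<dots> = real_of_int (den l) * (real_of_int (den r) / real_of_int (den w))"
      using convergent_value[of l c r] pos by (simp add: s(1))
    also have "\<dots> \<le> real_of_int q * (real_of_int \<bar>q * num w - p' * den w\<bar> / real_of_int (den w))"
      using s pp b2 by (intro mult_mono divide_right_mono) (simp_all del: of_int_abs)
    also have "\<dots> = ?f q" unfolding p' scale by simp
    finally show ?thesis .
  qed
  show "Zval (num w) (den w) = 1 / lam"
    unfolding Zval_def
  proof (rule antisym)
    show "Min (?f ` {q. 0 < q \<and> q < den w}) \<le> 1 / lam"
      using upper fin mem by (intro order_trans[OF Min_le upper]) auto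
    show "1 / lam \<le> Min (?f ` {q. 0 < q \<and> q < den w})"
      using lower fin mem by (subst Min_ge_iff) auto
  qed
qed

text \<open>All sums c + [0; rev l, u] + [0; r] of splittings l c r of the word are at most lam, where the
  context u to the left of the word enters only through its value t = [0; u].\<close>

fun bounded_from :: "real \<Rightarrow> real \<Rightarrow> int list \<Rightarrow> bool" where
  "bounded_from lam t [] \<longleftrightarrow> True"
| "bounded_from lam t (a # w) \<longleftrightarrow>
    real_of_int a + t + cf w \<le> lam \<and> bounded_from lam (1 / (real_of_int a + t)) w"

text \<open>Here \<open>u\<close> is the part already read; reading \<open>a\<close> turns
  \<open>cf (rev u)\<close> into 1 / (a + \<open>cf (rev u)\<close>), which is the recursive update
  of t.\<close>

lemma bounded_from_split:
  assumes "bounded_from lam (cf (rev u)) (l @ c # r)"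
  shows "real_of_int c + cf (rev (u @ l)) + cf r \<le> lam"
  using assms
proof (induction l arbitrary: u)
  case (Cons a l)
  then show ?case using Cons.IH[of "u @ [a]"] by simp
qed simp

lemma Zspec_continued_fraction:
  assumes "\<forall>a\<in>set (l0 @ c0 # r0). 1 \<le> a" "2 \<le> c0"
    and "bounded_from (real_of_int c0 + cf (rev l0) + cf r0) 0 (l0 @ c0 # r0)"
  shows "1 / (real_of_int c0 + cf (rev l0) + cf r0) \<in> Zspec"
proof -
  let ?w = "l0 @ c0 # r0"
  have "real_of_int c + cf (rev l) + cf r \<le> real_of_int c0 + cf (rev l0) + cf r0"
    if "?w = l @ c # r" for l c r
    using bounded_from_split[of _ "[]" l c r] assms(3) unfolding that by simp
  note Z = Zval_continued_fraction[OF assms(1) refl assms(2) refl this]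
  show ?thesis
    unfolding Zspec_def mem_Collect_eq
    by (intro exI[of _ "num ?w"] exI[of _ "den ?w"] conjI Z(1) Z(2)[symmetric] coprime_num_den)
qed

section \<open>Runs of ones\<close>

text \<open>Prefixing 1, 1 to a continued fraction.\<close>

definition R :: "real \<Rightarrow> real" where "R t = (1 + t) / (2 + t)"

text \<open>The value of [0; 1, 1, 1, ...], hence the fixed point of \<open>R\<close>.\<close>

definition golden :: real where "golden = (sqrt 5 - 1) / 2"

lemma golden_eq: "golden * golden + golden = 1"
  by (simp add: golden_def field_simps)

lemma golden_bounds: "61/100 < golden" "golden < 62/100"
proof -
  have "golden > 0" by (simp add: golden_def)
  show "61/100 < golden"
  proof (rule ccontr)
    assume c: "\<not> 61/100 < golden"
    then have "golden * golden \<le> (61/100) * (61/100)" using \<open>golden > 0\<close> by (intro mult_mono) auto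
    then show False using golden_eq c by simp
  qed
  show "golden < 62/100"
  proof (rule ccontr)
    assume c: "\<not> golden < 62/100"
    then have "(62/100) * (62/100) \<le> golden * golden" by (intro mult_mono) auto
    then show False using golden_eq c by simp
  qed
qed

lemma R_golden: "R golden = golden"
proof -
  have "1 + golden = golden * (2 + golden)" using golden_eq by (simp add: algebra_simps)
  then show ?thesis unfolding R_def using golden_bounds by (simp add: field_simps)
qed

text \<open>This formula yields both monotonicity and contraction by a factor of at least 4.\<close>

lemma R_diff:
  assumes "0 \<le> s" "0 \<le> t"
  shows "R t - R s = (t - s) / ((2 + t) * (2 + s))"
  unfolding R_def using assms by (simp add: field_simps)

lemma R_mono: "0 \<le> s \<Longrightarrow> s \<le> t \<Longrightarrow> R s \<le> R t"
proof -
  assume "0 \<le> s" "s \<le> t"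
  then have "0 \<le> (t - s) / ((2 + t) * (2 + s))" by (intro divide_nonneg_nonneg) auto
  then show ?thesis using R_diff[of s t] \<open>0 \<le> s\<close> \<open>s \<le> t\<close> by linarith
qed

lemma R_le_1: "0 \<le> t \<Longrightarrow> R t \<le> 1"
  by (simp add: R_def)

lemma R_nonneg: "0 \<le> t \<Longrightarrow> 0 \<le> R t"
  by (simp add: R_def)

lemma funpow_R_nonneg: "0 \<le> t \<Longrightarrow> 0 \<le> (R ^^ k) t"
  by (induction k) (auto simp: R_nonneg)

lemma funpow_R_mono: "0 \<le> s \<Longrightarrow> s \<le> t \<Longrightarrow> (R ^^ k) s \<le> (R ^^ k) t"
  by (induction k) (auto intro!: R_mono funpow_R_nonneg)

lemma funpow_R_le_golden: "0 \<le> t \<Longrightarrow> t \<le> golden \<Longrightarrow> (R ^^ k) t \<le> golden"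
proof (induction k)
  case (Suc k)
  then show ?case using R_mono[of "(R ^^ k) t" golden] funpow_R_nonneg[of t k] by (simp add: R_golden)
qed simp

lemma funpow_R_le_1: "0 \<le> t \<Longrightarrow> t \<le> 1 \<Longrightarrow> (R ^^ k) t \<le> 1"
  by (induction k) (auto simp: R_le_1 funpow_R_nonneg)

lemma inj_on_R: "inj_on R {0..}"
  by (rule inj_onI) (auto simp: R_def field_simps)

lemma inj_on_funpow_R: "inj_on (R ^^ k) {0..}"
proof (rule inj_onI)
  fix x y :: real assume "x \<in> {0..}" "y \<in> {0..}" "(R ^^ k) x = (R ^^ k) y"
  then show "x = y"
  proof (induction k)
    case (Suc k)
    then show ?case using inj_onD[OF inj_on_R, of "(R ^^ k) x" "(R ^^ k) y"] funpow_R_nonneg by auto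
  qed simp
qed

lemma continuous_on_funpow_R: "continuous_on {0..} (R ^^ k)"
proof (induction k)
  case (Suc k)
  have "continuous_on {0..} R" unfolding R_def by (intro continuous_intros) auto
  then have "continuous_on ((R ^^ k) ` {0..}) R"
    by (rule continuous_on_subset) (auto simp: funpow_R_nonneg)
  then show ?case using continuous_on_compose[OF Suc] by simp
qed (simp add: id_def)

text \<open>The value of a word consisting of 2k ones.\<close>

definition rho :: "nat \<Rightarrow> real" where "rho k = (R ^^ k) 0"

lemma rho_Suc: "rho (Suc k) = R (rho k)"
  by (simp add: rho_def)

lemma rho_nonneg: "0 \<le> rho k"
  by (simp add: rho_def funpow_R_nonneg)

lemma rho_less_golden: "rho k < golden"
proof (induction k)
  case 0
  then show ?case using golden_bounds by (simp add: rho_def)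
next
  case (Suc k)
  then have "0 < (golden - rho k) / ((2 + golden) * (2 + rho k))"
    using rho_nonneg[of k] golden_bounds by (intro divide_pos_pos mult_pos_pos) auto
  then show ?case using R_diff[of "rho k" golden] rho_nonneg[of k] golden_bounds
    by (simp add: rho_Suc R_golden)
qed

lemma golden_diff_rho_Suc: "golden - rho (Suc k) \<le> (golden - rho k) / 4"
proof -
  have "2 * 2 \<le> (2 + golden) * (2 + rho k)"
    using rho_nonneg[of k] golden_bounds by (intro mult_mono) auto
  then have "(golden - rho k) / ((2 + golden) * (2 + rho k)) \<le> (golden - rho k) / 4"
    using rho_less_golden[of k] by (intro divide_left_mono) auto
  then show ?thesis using R_diff[of "rho k" golden] rho_nonneg[of k] golden_bounds
    by (simp add: rho_Suc R_golden)
qed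

text \<open>The gap to \<open>golden\<close> is positive and shrinks at least fourfold.\<close>

lemma rho_less_Suc: "rho k < rho (Suc k)"
  using golden_diff_rho_Suc[of k] rho_less_golden[of k] by (simp add: field_simps)

lemma golden_diff_rho: "golden - rho k \<le> (1/4) ^ k"
proof (induction k)
  case 0
  then show ?case using golden_bounds by (simp add: rho_def)
next
  case (Suc k)
  then show ?case using golden_diff_rho_Suc[of k] by simp
qed

lemma rho_mono: "j \<le> k \<Longrightarrow> rho j \<le> rho k"
  by (rule lift_Suc_mono_le[of rho]) (rule less_imp_le[OF rho_less_Suc])

lemma funpow_R_ge_rho: "j \<le> k \<Longrightarrow> 0 \<le> t \<Longrightarrow> rho j \<le> (R ^^ k) t"
  using rho_mono[of j k] funpow_R_mono[of 0 t k] by (simp add: rho_def)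

section \<open>Runs of ones inside a longer word\<close>

lemma replicate_double_Suc: "replicate (2 * Suc k) x = x # x # replicate (2 * k) x"
  by simp

lemma cf_ones:
  assumes "0 \<le> cf w"
  shows "cf (replicate (2 * k) 1 @ w) = (R ^^ k) (cf w)"
proof (induction k)
  case (Suc k)
  have "1 / (1 + 1 / (1 + t)) = R t" if "0 \<le> t" for t
    using that by (simp add: R_def field_simps)
  from this[OF funpow_R_nonneg[OF assms, of k]] show ?case
    using Suc unfolding replicate_double_Suc by simp
qed simp

text \<open>At a letter 1 the sum is 1 plus two values in [0, 1], hence at most 3. Each pair of ones
  applies \<open>R\<close> to the left context.\<close>

lemma bounded_from_ones:
  assumes "0 \<le> t" "t \<le> 1" "0 \<le> cf w" "cf w \<le> 1" "3 \<le> lam"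
    and "bounded_from lam ((R ^^ k) t) w"
  shows "bounded_from lam t (replicate (2 * k) 1 @ w)"
  using assms(1,2,6)
proof (induction k arbitrary: t)
  case (Suc k)
  let ?v = "replicate (2 * k) 1 @ w"
  have v: "0 \<le> cf ?v" "cf ?v \<le> 1"
    using cf_ones[OF assms(3)] funpow_R_nonneg funpow_R_le_1 assms(3,4) by auto
  have Rt: "1 / (1 + 1 / (1 + t)) = R t" using Suc.prems by (simp add: R_def field_simps)
  have "bounded_from lam (R t) ?v"
  proof (rule Suc.IH)
    show "0 \<le> R t" "R t \<le> 1" using Suc.prems by (auto simp: R_def)
    show "bounded_from lam ((R ^^ k) (R t)) w" using Suc.prems(3) by (simp add: funpow_swap1)
  qed
  moreover have "1 / (1 + cf ?v) \<le> 1" "1 / (1 + t) \<le> 1" using v Suc.prems by auto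
  then have "1 + t + 1 / (1 + cf ?v) \<le> lam" "1 + 1 / (1 + t) + cf ?v \<le> lam"
    using Suc.prems v assms(5) by linarith+
  ultimately show ?case using Rt unfolding replicate_double_Suc by simp
qed simp

section \<open>The words\<close>

text \<open>Prefixes a run of 2(N+2) or 2(N+3) ones, then 22, to a continued fraction of value
  t.\<close>

definition T :: "nat \<Rightarrow> bool \<Rightarrow> real \<Rightarrow> real" where
  "T N b t = (R ^^ (N + 2 + of_bool b)) (1 / (2 + 1 / (2 + t)))"

text \<open>The closing run of ones gives the last pair 22 a long run on its right too.\<close>

fun tail_word :: "nat \<Rightarrow> bool list \<Rightarrow> int list" where
  "tail_word N [] = replicate (2 * (N + 2)) 1"
| "tail_word N (b # bs) = replicate (2 * (N + 2 + of_bool b)) 1 @ 2 # 2 # tail_word N bs"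

lemma tail_word_pos: "\<forall>a\<in>set (tail_word N bs). 1 \<le> a"
  by (induction bs) auto

lemma cf_tail_word: "cf (tail_word N bs) = foldr (T N) bs (rho (N + 2))"
proof (induction bs)
  case Nil
  then show ?case using cf_ones[of "[]" "N + 2"] by (simp add: rho_def)
next
  case (Cons b bs)
  have "0 \<le> cf (2 # 2 # tail_word N bs)"
    using cf_bounds[of "2 # 2 # tail_word N bs"] tail_word_pos[of N bs] by auto
  from cf_ones[OF this, of "N + 2 + of_bool b"] Cons show ?case
    by (simp add: T_def)
qed

lemma double_two_bounds:
  assumes "0 \<le> (t::real)" "t \<le> 1"
  shows "2 / 5 \<le> 1 / (2 + 1 / (2 + t))" "1 / (2 + 1 / (2 + t)) \<le> 3 / 7"
  using assms by (auto simp: field_simps)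

lemma T_bounds:
  assumes "0 \<le> t" "t \<le> 1"
  shows "rho (N + 2) \<le> T N b t" "T N b t \<le> golden"
proof -
  have "0 \<le> 1 / (2 + 1 / (2 + t))" "1 / (2 + 1 / (2 + t)) \<le> golden"
    using double_two_bounds[OF assms] golden_bounds by linarith+
  then show "rho (N + 2) \<le> T N b t" "T N b t \<le> golden"
    unfolding T_def by (intro funpow_R_ge_rho funpow_R_le_golden; simp)+
qed

lemma tail_word_bounds:
  "rho (N + 2) \<le> cf (tail_word N bs)" "cf (tail_word N bs) \<le> golden"
proof -
  have "rho (N + 2) \<le> foldr (T N) bs (rho (N + 2)) \<and> foldr (T N) bs (rho (N + 2)) \<le> golden"
  proof (induction bs)
    case Nil
    then show ?case using rho_less_golden[of "N + 2"] by simp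
  next
    case (Cons b bs)
    then show ?case using T_bounds rho_nonneg[of "N + 2"] golden_bounds by auto
  qed
  then show "rho (N + 2) \<le> cf (tail_word N bs)" "cf (tail_word N bs) \<le> golden"
    by (auto simp: cf_tail_word)
qed

text \<open>At a pair 22 the values of both neighbouring sides lie between
  \<open>rho (N + 2)\<close> and \<open>golden\<close>, which bounds both sums there; letters 1
  contribute at most 3.\<close>

lemma bounded_from_tail_word:
  assumes "0 \<le> t" "t \<le> golden" and lam: "3 \<le> lam" "2 + golden + 1 / (2 + rho (N + 2)) \<le> lam"
  shows "bounded_from lam t (tail_word N bs)"
  using assms(1,2)
proof (induction bs arbitrary: t)
  case Nil
  then show ?case using bounded_from_ones[of t "[]" lam "N + 2"] lam golden_bounds by simp
next
  case (Cons b bs)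
  let ?k = "N + 2 + of_bool b"
  let ?v = "tail_word N bs"
  define t' where "t' = (R ^^ ?k) t"
  have t': "rho (N + 2) \<le> t'" "t' \<le> golden"
    unfolding t'_def using Cons.prems by (auto intro!: funpow_R_ge_rho funpow_R_le_golden simp del: funpow.simps)
  \<comment> \<open>Serves both letters of the pair: x and y are the two sides, with roles exchanged
    for the second letter.\<close>
  have key: "2 + x + 1 / (2 + y) \<le> lam" if "x \<le> golden" "rho (N + 2) \<le> y" for x y
  proof -
    have "1 / (2 + y) \<le> 1 / (2 + rho (N + 2))"
      using that rho_nonneg[of "N + 2"] by (intro divide_left_mono) auto
    then show ?thesis using that lam by linarith
  qed
  have nn: "0 \<le> t'" using t' rho_nonneg[of "N + 2"] by linarith
  have "bounded_from lam t' (2 # 2 # ?v)"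
  proof -
    have "bounded_from lam (1 / (2 + 1 / (2 + t'))) ?v"
      using double_two_bounds[of t'] nn t' golden_bounds by (intro Cons.IH) auto
    then show ?thesis
      using key[OF t'(2) tail_word_bounds(1)] key[OF tail_word_bounds(2) t'(1)] by (simp add: add_ac)
  qed
  moreover have "0 \<le> cf (2 # 2 # ?v)" "cf (2 # 2 # ?v) \<le> 1"
    using cf_bounds[of "2 # 2 # ?v"] tail_word_pos[of N bs] by auto
  ultimately show ?case
    using bounded_from_ones[of t "2 # 2 # ?v" lam ?k] Cons.prems lam golden_bounds
    unfolding t'_def by simp
qed

text \<open>The reciprocal of the sum centred at the second 2 of the first pair 22, with 2, 1^(2N)
  on its left and a tail of value s on its right.\<close>

definition value_of :: "nat \<Rightarrow> real \<Rightarrow> real" where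
  "value_of N s = 1 / (2 + 1 / (2 + rho N) + s)"

text \<open>This is the identity [2; 1, 1, t] + [0; 2, t] = 3.\<close>

lemma one_minus_R: "0 \<le> t \<Longrightarrow> 1 / (2 + t) = 1 - R t"
  by (simp add: R_def field_simps)

text \<open>The sum equals 3 + s - \<open>rho (Suc N)\<close>, so the bounds on s place it just
  above 3.\<close>

lemma value_bounds:
  assumes "rho (N + 2) \<le> s" "s \<le> golden"
  shows "3 < 2 + 1 / (2 + rho N) + s" "2 + 1 / (2 + rho N) + s \<le> 3 + (1/4) ^ N"
proof -
  have e: "1 / (2 + rho N) = 1 - rho (Suc N)"
    unfolding rho_Suc by (rule one_minus_R[OF rho_nonneg])
  show "3 < 2 + 1 / (2 + rho N) + s"
    using e rho_less_Suc[of "Suc N"] assms by simp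
  show "2 + 1 / (2 + rho N) + s \<le> 3 + (1/4) ^ N"
    using e golden_diff_rho[of N] rho_less_Suc[of N] assms by simp
qed

text \<open>Every pair 22 but the first has runs of length at least 2(N+2) on both sides; the left-hand side
  bounds the sums there, the right-hand side is the sum at the first pair.\<close>

lemma main_dominates:
  assumes "rho (N + 2) \<le> s"
  shows "2 + golden + 1 / (2 + rho (N + 2)) \<le> 2 + 1 / (2 + rho N) + s"
proof -
  define d where "d = golden - rho N"
  have d0: "0 \<le> d" using rho_less_golden[of N] by (simp add: d_def)
  have g: "golden - rho (N + 2) \<le> d / 16"
    using golden_diff_rho_Suc[of N] golden_diff_rho_Suc[of "Suc N"] by (simp add: d_def)
  have lt: "rho (N + 2) < golden" "rho N < golden" by (rule rho_less_golden)+
  have nn: "0 \<le> rho (N + 2)" "0 \<le> rho N" by (rule rho_nonneg)+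
  \<comment> \<open>Both factors are below 3, so the reciprocals differ by at least 15d/144, which
    beats the loss \<open>golden\<close> - s of at most d/16 = 9d/144.\<close>
  have "(2 + rho (N + 2)) * (2 + rho N) \<le> 3 * 3"
    using lt golden_bounds nn by (intro mult_mono) auto
  then have "(15/16 * d) / (3 * 3) \<le> (rho (N + 2) - rho N) / ((2 + rho (N + 2)) * (2 + rho N))"
    using g d0 nn by (intro frac_le) (auto simp: d_def)
  also have "\<dots> = 1 / (2 + rho N) - 1 / (2 + rho (N + 2))"
    using nn by (simp add: field_simps)
  finally show ?thesis using g d0 assms by simp
qed

lemma value_in_Zspec: "value_of N (cf (tail_word N bs)) \<in> Zspec"
proof -
  let ?v = "tail_word N bs"
  define s where "s = cf ?v"
  let ?l = "replicate (2 * N) 1 @ [2]"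
  define lam where "lam = 2 + 1 / (2 + rho N) + s"
  have s: "rho (N + 2) \<le> s" "s \<le> golden" unfolding s_def by (rule tail_word_bounds)+
  have lam3: "3 \<le> lam" using value_bounds(1)[OF s] by (simp add: lam_def)
  have nn: "0 \<le> rho N" and rg: "rho N \<le> golden" using rho_nonneg rho_less_golden[of N] by auto
  have rs: "rho N \<le> s" using rho_mono[of N "N + 2"] s by simp
  have l: "cf (rev ?l) = 1 / (2 + rho N)"
    using cf_ones[of "[]" N] by (simp add: rho_def)
  \<comment> \<open>The first 2 of the pair does no better than the second, because the run on the
    left is the shorter one and rho N is at most s.\<close>
  have "1 / (2 + s) \<le> 1 / (2 + rho N)" using rs nn by (intro divide_left_mono) auto
  then have "rho N + 1 / (2 + s) \<le> 1 / (2 + rho N) + s" using rs by linarith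
  moreover have "bounded_from lam (1 / (2 + 1 / (2 + rho N))) ?v"
  proof (rule bounded_from_tail_word[OF _ _ lam3])
    show "2 + golden + 1 / (2 + rho (N + 2)) \<le> lam"
      unfolding lam_def by (rule main_dominates[OF s(1)])
  qed (use double_two_bounds[of "rho N"] nn rg golden_bounds in auto)
  ultimately have "bounded_from lam (rho N) (2 # 2 # ?v)"
    by (simp add: lam_def s_def)
  moreover have "0 \<le> cf (2 # 2 # ?v)" "cf (2 # 2 # ?v) \<le> 1"
    using cf_bounds[of "2 # 2 # ?v"] tail_word_pos[of N bs] by auto
  ultimately have "bounded_from lam 0 (replicate (2 * N) 1 @ 2 # 2 # ?v)"
    using bounded_from_ones[of 0 "2 # 2 # ?v" lam N] lam3 by (simp add: rho_def)
  then have "1 / (real_of_int 2 + cf (rev ?l) + cf ?v) \<in> Zspec"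
    using tail_word_pos[of N bs]
    by (intro Zspec_continued_fraction) (auto simp: l lam_def s_def simp del: rev_append)
  then show ?thesis unfolding l value_of_def by simp
qed

section \<open>Uncountably many limits\<close>

lemma uncountable_UNIV_nat_set: "uncountable (UNIV :: nat set set)"
proof
  assume "countable (UNIV :: nat set set)"
  then obtain f :: "nat \<Rightarrow> nat set" where "range f = UNIV"
    using uncountable_def[of "UNIV :: nat set set"] by blast
  then show False using Cantors_theorem[of "UNIV :: nat set"] by auto
qed

text \<open>Each set A of naturals prescribes an infinite bit sequence; compactness gives a cluster
  point of the orbit along its prefixes, lying in all the nested images of J. Two sets part at a
  first index, where disjointness and injectivity separate their points.\<close>

lemma uncountable_closure_of_disjoint_images:
  fixes T :: "bool \<Rightarrow> 'a::metric_space \<Rightarrow> 'a"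
  assumes J: "compact J" and x0: "x0 \<in> J"
    and cont: "\<And>b. continuous_on J (T b)" and inj: "\<And>b. inj_on (T b) J"
    and maps: "\<And>b x. x \<in> J \<Longrightarrow> T b x \<in> J"
    and disj: "T True ` J \<inter> T False ` J = {}"
  shows "uncountable (closure (range (\<lambda>bs. foldr T bs x0)))"
proof -
  define word where "word A n = map (\<lambda>i. i \<in> A) [0..<n]" for A :: "nat set" and n
  have fold_maps: "foldr T bs x \<in> J" if "x \<in> J" for bs x
    using that by (induction bs) (auto intro: maps)
  have fold_cont: "continuous_on J (foldr T bs)" for bs
  proof (induction bs)
    case (Cons b bs)
    have "continuous_on (foldr T bs ` J) (T b)"
      by (rule continuous_on_subset[OF cont]) (auto intro: fold_maps)
    then show ?case using continuous_on_compose[OF Cons, of "T b"] by (simp add: o_def)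
  qed (simp add: id_def)
  have fold_inj: "inj_on (foldr T bs) J" for bs
  proof (induction bs)
    case (Cons b bs)
    have "inj_on (T b) (foldr T bs ` J)"
      by (rule inj_on_subset[OF inj]) (auto intro: fold_maps)
    then show ?case using comp_inj_on[OF Cons, of "T b"] by (simp add: o_def)
  qed simp
  have word_split: "\<exists>bs. word A m = word A n @ bs" if "n \<le> m" for A n m
  proof -
    have "[0..<m] = [0..<n] @ [n..<m]" using that upt_add_eq_append[of 0 n "m - n"] by simp
    then show ?thesis by (auto simp: word_def)
  qed
  have "\<exists>x. x \<in> closure (range (\<lambda>bs. foldr T bs x0)) \<and> (\<forall>n. x \<in> foldr T (word A n) ` J)" for A
  proof -
    have "seq_compact J" using J compact_imp_seq_compact by blast
    then obtain x r where r: "strict_mono (r :: nat \<Rightarrow> nat)"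
      and lim: "((\<lambda>n. foldr T (word A n) x0) \<circ> r) \<longlonglongrightarrow> x"
      using fold_maps[OF x0] unfolding seq_compact_def by metis
    have "x \<in> closure (range (\<lambda>bs. foldr T bs x0))"
      unfolding closure_sequential using lim by (intro exI[of _ "(\<lambda>n. foldr T (word A n) x0) \<circ> r"]) auto
    moreover have "x \<in> foldr T (word A n) ` J" for n
    proof (rule Lim_in_closed_set[OF _ _ _ lim])
      \<comment> \<open>Closedness keeps the limit in the n-th image, as all later prefixes extend
        the n-th one.\<close>
      show "closed (foldr T (word A n) ` J)"
        using compact_continuous_image[OF fold_cont J] compact_imp_closed by blast
      show "\<forall>\<^sub>F k in sequentially. ((\<lambda>n. foldr T (word A n) x0) \<circ> r) k \<in> foldr T (word A n) ` J"
      proof (rule eventually_sequentiallyI[of n])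
        fix k assume "n \<le> k"
        then have "n \<le> r k" using seq_suble[OF r, of k] by simp
        from word_split[OF this] obtain bs where "word A (r k) = word A n @ bs" by blast
        then show "((\<lambda>n. foldr T (word A n) x0) \<circ> r) k \<in> foldr T (word A n) ` J"
          using fold_maps[OF x0, of bs] by auto
      qed
    qed auto
    ultimately show ?thesis by blast
  qed
  then obtain L where L: "\<And>A. L A \<in> closure (range (\<lambda>bs. foldr T bs x0))"
    "\<And>A n. L A \<in> foldr T (word A n) ` J" by metis
  have "inj L"
  proof (rule injI, rule ccontr)
    fix A B assume eq: "L A = L B" and "A \<noteq> B"
    then have "\<exists>n. (n \<in> A) \<noteq> (n \<in> B)" by blast
    then obtain n where n: "(n \<in> A) \<noteq> (n \<in> B)" and least: "\<And>k. k < n \<Longrightarrow> (k \<in> A) = (k \<in> B)"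
      using exists_least_iff[of "\<lambda>n. (n \<in> A) \<noteq> (n \<in> B)"] by blast
    have "word A n = word B n" using least by (auto simp: word_def)
    moreover have "word A (Suc n) = word A n @ [n \<in> A]" "word B (Suc n) = word B n @ [n \<in> B]"
      by (auto simp: word_def)
    moreover obtain x y where xy: "x \<in> J" "y \<in> J"
      "L A = foldr T (word A (Suc n)) x" "L B = foldr T (word B (Suc n)) y"
      using L(2)[of A "Suc n"] L(2)[of B "Suc n"] by blast
    \<comment> \<open>Only the common prefix is left outside, and injectivity strips it.\<close>
    ultimately have "foldr T (word A n) (T (n \<in> A) x) = foldr T (word A n) (T (n \<in> B) y)"
      using eq by simp
    then have "T (n \<in> A) x = T (n \<in> B) y"
      using inj_onD[OF fold_inj] maps xy by blast
    moreover have "T True u \<noteq> T False v" if "u \<in> J" "v \<in> J" for u v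
      using disj that by blast
    ultimately show False using n xy(1,2) by (metis (full_types))
  qed
  then have "uncountable (range L)"
    using uncountable_UNIV_nat_set countable_image_inj_eq by blast
  then show ?thesis using L(1) countable_subset[of "range L"] by blast
qed

lemma uncountable_closure_tail_values:
  "uncountable (closure (range (\<lambda>bs. cf (tail_word N bs))))"
  unfolding cf_tail_word
proof (rule uncountable_closure_of_disjoint_images[where J = "{0..1}"])
  let ?h = "\<lambda>t::real. 1 / (2 + 1 / (2 + t))"
  have h: "0 \<le> ?h t" "?h t \<le> 3 / 7" if "t \<in> {0..1}" for t
    using double_two_bounds[of t] that by auto
  have T_h: "T N b = (R ^^ (N + 2 + of_bool b)) \<circ> ?h" for b by (auto simp: T_def)
  show "compact {0..1::real}" by simp
  show "rho (N + 2) \<in> {0..1}"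
    using rho_nonneg[of "N + 2"] rho_less_golden[of "N + 2"] golden_bounds by auto
  have pos: "2 + 1 / (2 + t) \<noteq> 0" if "t \<in> {0..1}" for t :: real
  proof -
    have "0 \<le> 1 / (2 + t)" using that by auto
    then show ?thesis by linarith
  qed
  fix b
  have "continuous_on {0..1} ?h" by (intro continuous_intros) (use pos in auto)
  moreover have "continuous_on (?h ` {0..1}) (R ^^ (N + 2 + of_bool b))"
    by (rule continuous_on_subset[OF continuous_on_funpow_R]) (use h in auto)
  ultimately show "continuous_on {0..1} (T N b)" unfolding T_h by (rule continuous_on_compose)
  have "inj_on ?h {0..1}" by (rule inj_onI) auto
  moreover have "inj_on (R ^^ (N + 2 + of_bool b)) (?h ` {0..1})"
    by (rule inj_on_subset[OF inj_on_funpow_R]) (use h in auto)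
  ultimately show "inj_on (T N b) {0..1}" unfolding T_h by (rule comp_inj_on)
  show "T N b t \<in> {0..1}" if "t \<in> {0..1}" for t
    using T_bounds[of t N b] that rho_nonneg[of "N + 2"] golden_bounds by auto
next
  show "T N True ` {0..1} \<inter> T N False ` {0..1} = {}"
  proof (rule ccontr)
    let ?h = "\<lambda>t::real. 1 / (2 + 1 / (2 + t))"
    assume "\<not> ?thesis"
    then obtain x y where xy: "x \<in> {0..1}" "y \<in> {0..1}" "T N True x = T N False y" by blast
    have h: "0 \<le> ?h x" "0 \<le> ?h y" "?h y \<le> 3 / 7"
      using double_two_bounds[of x] double_two_bounds[of y] xy by auto
    \<comment> \<open>Cancelling the common run leaves one extra \<open>R\<close> on the left;
      \<open>R\<close> is at least 1/2 on nonnegative reals, while \<open>?h\<close> is at most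
      3/7.\<close>
    have "(R ^^ (N + 2)) (R (?h x)) = (R ^^ (N + 2)) (?h y)"
      using xy(3) by (simp add: T_def funpow_swap1)
    then have "R (?h x) = ?h y"
      using inj_onD[OF inj_on_funpow_R] h R_nonneg by (metis atLeast_iff)
    moreover have "R 0 \<le> R (?h x)" using R_mono[of 0 "?h x"] h by linarith
    then have "1 / 2 \<le> R (?h x)" unfolding R_def[of 0] by simp
    ultimately show False using h by linarith
  qed
qed

lemma countable_Zspec: "countable Zspec"
proof -
  have "Zspec \<subseteq> range (\<lambda>(a, b). Zval a b)" unfolding Zspec_def by auto
  then show ?thesis by (rule countable_subset) auto
qed

theorem theorem2:
  fixes \<epsilon> :: real
  assumes "\<epsilon> > 0"
  shows "uncountable {x. x islimpt Zspec \<and> 1/3 - \<epsilon> < x \<and> x < 1/3}"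
proof
  let ?P = "{x. x islimpt Zspec \<and> 1/3 - \<epsilon> < x \<and> x < 1/3}"
  assume "countable ?P"
  \<comment> \<open>By \<open>value_bounds\<close> the sums then lie between 3 and 3 +
    \<epsilon>.\<close>
  obtain N where N: "(1/4::real) ^ N < \<epsilon>"
    using real_arch_pow_inv[of \<epsilon> "1/4"] assms by auto
  define X where "X = closure (range (\<lambda>bs. cf (tail_word N bs)))"
  have X: "rho (N + 2) \<le> s" "s \<le> golden" if "s \<in> X" for s
  proof -
    have "X \<subseteq> {rho (N + 2)..golden}"
      unfolding X_def by (rule closure_minimal) (use tail_word_bounds in auto)
    then show "rho (N + 2) \<le> s" "s \<le> golden" using that by auto
  qed
  have pos: "0 < 2 + 1 / (2 + rho N) + s" if "s \<in> X" for s
    using value_bounds(1)[OF X[OF that]] by simp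
  have "continuous_on X (value_of N)"
    unfolding value_of_def using rho_nonneg[of N]
    by (intro continuous_intros) (use pos in force)+
  then have "value_of N ` X \<subseteq> closure Zspec"
    unfolding X_def
    by (rule image_closure_subset) (use value_in_Zspec closure_subset in auto)
  moreover have "1/3 - \<epsilon> < value_of N s \<and> value_of N s < 1/3" if "s \<in> X" for s
  proof -
    define y where "y = 2 + 1 / (2 + rho N) + s"
    have y: "3 < y" "y < 3 + \<epsilon>"
      using value_bounds[OF X[OF that]] N by (auto simp: y_def)
    have "1/3 - 1/y = (y - 3) / (3 * y)" using y by (simp add: field_simps)
    also have "\<dots> \<le> (y - 3) / 1" using y by (intro divide_left_mono) auto
    finally have "1/3 - \<epsilon> < 1/y" using y by simp
    moreover have "1/y < 1/3" using y by (simp add: field_simps)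
    ultimately show ?thesis by (simp add: value_of_def y_def)
  qed
  \<comment> \<open>A point of the closure is a limit point or belongs to the countable set
    \<open>Zspec\<close>.\<close>
  ultimately have "value_of N ` X \<subseteq> ?P \<union> Zspec"
    unfolding closure_def by blast
  then have "countable (value_of N ` X)"
    using countable_subset countable_Un[OF \<open>countable ?P\<close> countable_Zspec] by blast
  moreover have "inj_on (value_of N) X"
    by (rule inj_onI) (simp add: value_of_def)
  ultimately have "countable X" using countable_image_inj_on by blast
  then show False using uncountable_closure_tail_values unfolding X_def by blast
qed

end
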